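(* Let $(K,\mathrm{dist})$ be a compact metric space and let $f:K\to K$ be a surjective continuous mapping having the ergodic inverse shadowing property (EIS). Then for any $\varepsilon>0$ there exists a $d>0$ such that if $g:K\to K$ is a continuous mapping with $\mathrm{dist}_{C^0}(f,g)<d$, then the $\varepsilon$-neighbourhood of any minimal point of $f$ contains a Poisson stable point of $g$.
   Context: $\mathbb{Z}_+=\{0,1,2,\dots\}$. $C(K,K)$ is the space of continuous mappings $K\to K$ with the metric $\mathrm{dist}_{C^0}(g,h)=\max_{x\in K}\mathrm{dist}(g(x),h(x))$. A method is a sequence $g=\{g_k\in C(K,K)\}_{k\in\mathbb{Z}_+}$; a trajectory of $g$ is a sequence $\{y_k\}_{k\in\mathbb{Z}_+}$ in $K$ with $y_{k+1}=g_k(y_k)$ for all $k$. For $d>0$, the method $g$ is a $d$-method for $f$ if $\mathrm{dist}_{C^0}(g_k,f)\le d$ for all $k\in\mathbb{Z}_+$. $\mathrm{Lip}_1$ is the set of functions $\varphi:K\to\mathbb{R}$ that are Lipschitz with constant at most $1$. A surjective continuous mapping $f:K\to K$ has the ergodic inverse shadowing property (EIS) if for any $\varepsilon>0$ there exists a $d>0$ such that for any trajectory $\{x_k=f^k(x):k\in\mathbb{Z}_+\}$ of $f$ and for any $d$-method $g$ for $f$ there exists a trajectory $\{y_k:k\in\mathbb{Z}_+\}$ of $g$ such that $\limsup_{n\to\infty}\frac1n\sum_{k=1}^n(\varphi(x_k)-\varphi(y_k))\le\varepsilon$ for every $\varphi\in\mathrm{Lip}_1$. A point $x\in K$ is Poisson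 stable for a mapping $h$ if there is a sequence $n_k\to\infty$ such that $h^{n_k}(x)\to x$. A point $x\in K$ is minimal for a mapping $h$ if $\overline{O^+_h(y)}=\overline{O^+_h(x)}$ for any $y\in\overline{O^+_h(x)}$, where $O^+_h(x)=\{h^k(x):k\in\mathbb{Z}_+\}$. *)

theory Defs
  imports "HOL-Analysis.Analysis"
begin

text \<open>
  The compact metric space is a compact subset \<open>K\<close> of an arbitrary metric space type, so that
  the self-maps of \<open>K\<close> are total functions of which only the values on \<open>K\<close> matter.
  Since such a \<open>K\<close> is closed, closures and limits in the ambient type of sets and sequences
  in \<open>K\<close> agree with those in \<open>K\<close>.
\<close>

definition cont_self_maps :: "'a::metric_space set \<Rightarrow> ('a \<Rightarrow> 'a) set" where
  "cont_self_maps K = {g. continuous_on K g \<and> g ` K \<subseteq> K}"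

text \<open>On a nonempty compact \<open>K\<close> and for continuous maps the supremum is attained.\<close>

definition dist_C0 :: "'a::metric_space set \<Rightarrow> ('a \<Rightarrow> 'a) \<Rightarrow> ('a \<Rightarrow> 'a) \<Rightarrow> real" where
  "dist_C0 K g h = (SUP x\<in>K. dist (g x) (h x))"

definition is_method :: "'a::metric_space set \<Rightarrow> (nat \<Rightarrow> 'a \<Rightarrow> 'a) \<Rightarrow> bool" where
  "is_method K g \<longleftrightarrow> (\<forall>k. g k \<in> cont_self_maps K)"

definition method_trajectory ::
    "'a::metric_space set \<Rightarrow> (nat \<Rightarrow> 'a \<Rightarrow> 'a) \<Rightarrow> (nat \<Rightarrow> 'a) \<Rightarrow> bool" where
  "method_trajectory K g y \<longleftrightarrow> (\<forall>k. y k \<in> K) \<and> (\<forall>k. y (Suc k) = g k (y k))"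

definition d_method ::
    "'a::metric_space set \<Rightarrow> real \<Rightarrow> ('a \<Rightarrow> 'a) \<Rightarrow> (nat \<Rightarrow> 'a \<Rightarrow> 'a) \<Rightarrow> bool" where
  "d_method K d f g \<longleftrightarrow> is_method K g \<and> (\<forall>k. dist_C0 K (g k) f \<le> d)"

definition Lip1 :: "'a::metric_space set \<Rightarrow> ('a \<Rightarrow> real) set" where
  "Lip1 K = {\<phi>. 1-lipschitz_on K \<phi>}"

text \<open>The upper limit is taken in the extended reals; the averages are bounded because \<open>K\<close> is.\<close>

definition EIS :: "'a::metric_space set \<Rightarrow> ('a \<Rightarrow> 'a) \<Rightarrow> bool" where
  "EIS K f \<longleftrightarrow>
     (\<forall>\<epsilon>>0. \<exists>d>0. \<forall>x\<in>K. \<forall>g. d_method K d f g \<longrightarrow>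
        (\<exists>y. method_trajectory K g y \<and>
          (\<forall>\<phi>\<in>Lip1 K.
             limsup (\<lambda>n. ereal (1 / real n * (\<Sum>k=1..n. (\<phi> ((f ^^ k) x) - \<phi> (y k))))) \<le> ereal \<epsilon>)))"

definition poisson_stable :: "'a::metric_space set \<Rightarrow> ('a \<Rightarrow> 'a) \<Rightarrow> 'a \<Rightarrow> bool" where
  "poisson_stable K h x \<longleftrightarrow>
     x \<in> K \<and> (\<exists>n :: nat \<Rightarrow> nat. filterlim n at_top sequentially \<and> (\<lambda>k. (h ^^ n k) x) \<longlonglongrightarrow> x)"

definition forward_orbit :: "('a \<Rightarrow> 'a) \<Rightarrow> 'a \<Rightarrow> 'a set" where
  "forward_orbit h x = range (\<lambda>k. (h ^^ k) x)"

definition minimal_point :: "'a::metric_space set \<Rightarrow> ('a \<Rightarrow> 'a) \<Rightarrow> 'a \<Rightarrow> bool" where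
  "minimal_point K h x \<longleftrightarrow>
     x \<in> K \<and> (\<forall>y \<in> closure (forward_orbit h x). closure (forward_orbit h y) = closure (forward_orbit h x))"

end

theory Submission
  imports Defs
begin

text \<open>
  The orbit of a minimal point \<open>x\<close> of \<open>f\<close> returns to a small ball around \<open>x\<close> with bounded gaps,
  so testing EIS (for the constant method \<open>g\<close>) against a Lipschitz bump at \<open>x\<close> yields an orbit of
  \<open>g\<close> which visits the ball on a set of times that is not of density zero. Recurrence then needs
  no invariant measure: a set of times which is not of density zero has, for arbitrarily large
  \<open>n\<close>, an intersection with its \<open>n\<close>-shift which again is not of density zero, so one can shrink the
  ball to nested compact sets such that on the \<open>i\<close>-th one some iterate \<open>g\<^sup>n\<close> with \<open>n \<ge> i\<close> moves
  points by at most \<open>1 / i\<close>. Their common point is Poisson stable. The number \<open>d\<close> is uniform in \<open>x\<close>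
  because finitely many minimal points approximate all of them.
\<close>

section \<open>Sets of times of density zero\<close>

text \<open>Times are counted in \<open>{1..n}\<close>, as in the sums of \<open>EIS\<close>. The
  negation, positive upper density, is the property that the proof propagates.\<close>

definition null_density :: "nat set \<Rightarrow> bool" where
  "null_density A \<longleftrightarrow> (\<lambda>n. real (card (A \<inter> {1..n})) / real n) \<longlonglongrightarrow> 0"

lemma null_densityI:
  assumes "\<And>e. e > 0 \<Longrightarrow> \<forall>\<^sub>F n in sequentially. real (card (A \<inter> {1..n})) / real n < e"
  shows "null_density A"
  unfolding null_density_def tendsto_iff
  using assms by simp

lemma null_densityD:
  assumes "null_density A" "e > 0"
  shows "\<forall>\<^sub>F n in sequentially. real (card (A \<inter> {1..n})) / real n < e"
  using assms unfolding null_density_def by (rule order_tendstoD)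

lemma null_density_subset:
  assumes "null_density B" "A \<subseteq> B"
  shows "null_density A"
proof (rule null_densityI)
  fix e :: real assume "e > 0"
  from null_densityD[OF assms(1) this]
  show "\<forall>\<^sub>F n in sequentially. real (card (A \<inter> {1..n})) / real n < e"
  proof eventually_elim
    case (elim n)
    have "card (A \<inter> {1..n}) \<le> card (B \<inter> {1..n})"
      using assms(2) by (intro card_mono) auto
    then have "real (card (A \<inter> {1..n})) / real n \<le> real (card (B \<inter> {1..n})) / real n"
      by (intro divide_right_mono) auto
    with elim show ?case by linarith
  qed
qed

lemma null_density_empty: "null_density {}"
  by (simp add: null_density_def)

lemma not_null_density_UNIV: "\<not> null_density UNIV"
proof
  assume "null_density UNIV"
  then have "\<forall>\<^sub>F n in sequentially. real (card (UNIV \<inter> {1..n})) / real n < 1"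
    by (rule null_densityD) simp
  with eventually_gt_at_top[of "0::nat"] have "\<forall>\<^sub>F n::nat in sequentially. False"
    by eventually_elim simp
  then show False by simp
qed

lemma null_density_Un:
  assumes "null_density A" "null_density B"
  shows "null_density (A \<union> B)"
proof (rule null_densityI)
  fix e :: real assume "e > 0"
  then have "e / 2 > 0" by simp
  from null_densityD[OF assms(1) this] null_densityD[OF assms(2) this]
  show "\<forall>\<^sub>F n in sequentially. real (card ((A \<union> B) \<inter> {1..n})) / real n < e"
  proof eventually_elim
    case (elim n)
    have "card ((A \<union> B) \<inter> {1..n}) \<le> card (A \<inter> {1..n}) + card (B \<inter> {1..n})"
      by (simp add: Int_Un_distrib2 card_Un_le)
    then have "real (card ((A \<union> B) \<inter> {1..n})) / real n
        \<le> (real (card (A \<inter> {1..n})) + real (card (B \<inter> {1..n}))) / real n"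
      by (intro divide_right_mono) linarith+
    with elim show ?case unfolding add_divide_distrib by linarith
  qed
qed

lemma null_density_UN:
  assumes "finite I" "\<And>i. i \<in> I \<Longrightarrow> null_density (A i)"
  shows "null_density (\<Union>i\<in>I. A i)"
  using assms by (induction I rule: finite_induct) (auto intro: null_density_Un null_density_empty)

text \<open>In \<open>{1..n}\<close> the shift by \<open>j\<close> lets in at most \<open>j\<close>
  further points, and \<open>j / n\<close> tends to 0.\<close>

lemma null_density_shift:
  assumes "null_density A"
  shows "null_density {k. k + j \<in> A}"
proof (rule null_densityI)
  fix e :: real assume "e > 0"
  then have "e / 2 > 0" by simp
  have "(\<lambda>n. real j / real n) \<longlonglongrightarrow> 0"
    by (rule lim_const_over_n)
  then have "\<forall>\<^sub>F n in sequentially. real j / real n < e / 2"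
    using \<open>e / 2 > 0\<close> by (rule order_tendstoD)
  with null_densityD[OF assms \<open>e / 2 > 0\<close>]
  show "\<forall>\<^sub>F n in sequentially. real (card ({k. k + j \<in> A} \<inter> {1..n})) / real n < e"
  proof eventually_elim
    case (elim n)
    have "card ({k. k + j \<in> A} \<inter> {1..n}) \<le> card (A \<inter> {1..n} \<union> {n+1..n+j})"
      by (rule card_inj_on_le[where f = "\<lambda>k. k + j"]) auto
    also have "\<dots> \<le> card (A \<inter> {1..n}) + j"
      using card_Un_le[of "A \<inter> {1..n}" "{n+1..n+j}"] by simp
    finally have "real (card ({k. k + j \<in> A} \<inter> {1..n})) / real n
        \<le> (real (card (A \<inter> {1..n})) + real j) / real n"
      by (intro divide_right_mono) linarith+
    with elim show ?case unfolding add_divide_distrib by linarith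
  qed
qed

section \<open>Return times of sets of positive upper density\<close>

text \<open>The translates of \<open>A \<inter> {1..n}\<close> by \<open>m * i\<close> with
  \<open>i < L\<close> are pairwise disjoint and lie in \<open>{1..n + L * m}\<close>, so comparing
  cardinalities gives the bound.\<close>

lemma card_of_no_return:
  fixes A :: "nat set"
  assumes "m > 0"
    and no_return: "\<And>a i. a \<in> A \<Longrightarrow> 0 < i \<Longrightarrow> i < L \<Longrightarrow> a + m * i \<notin> A"
  shows "L * card (A \<inter> {1..n}) \<le> n + L * m"
proof -
  let ?h = "\<lambda>(i, a). a + m * i"
  \<comment> \<open>By symmetry take \<open>i \<le> j\<close>: a coincidence with
    \<open>i < j\<close> would make \<open>b\<close> return to \<open>A\<close> after time
    \<open>m * (j - i)\<close>.\<close>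
  have aux: "i = j \<and> a = b"
    if "i \<le> j" "j < L" "a \<in> A" "b \<in> A" "a + m * i = b + m * j" for i j a b
  proof -
    have "a = b + m * (j - i)"
      using that by (simp add: diff_mult_distrib2)
    then show ?thesis
      using no_return[of b "j - i"] that by (cases "i = j") auto
  qed
  have "card ({..<L} \<times> (A \<inter> {1..n})) \<le> card {1..n + L * m}"
  proof (rule card_inj_on_le[where f = ?h])
    show "inj_on ?h ({..<L} \<times> (A \<inter> {1..n}))"
    proof (rule inj_onI, clarsimp)
      fix i a j b
      assume *: "i < L" "j < L" "a \<in> A" "b \<in> A" "a + m * i = b + m * j"
      show "i = j \<and> a = b"
        using aux[of i j a b] aux[of j i b a] * by (cases "i \<le> j") auto
    qed
    show "?h ` ({..<L} \<times> (A \<inter> {1..n})) \<subseteq> {1..n + L * m}"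
    proof clarsimp
      fix i a assume "i < L" "a \<le> n"
      then show "a + m * i \<le> n + L * m"
        by (metis add_mono less_imp_le mult.commute mult_le_mono2)
    qed
  qed simp
  then show ?thesis by simp
qed

text \<open>
  Remove from \<open>A\<close> the null set of its points returning at one of the times \<open>m, 2 m, \<dots>, (L - 1) m\<close>;
  the first \<open>L\<close> shifts of the remainder by multiples of \<open>m\<close> are disjoint, so its upper density is
  at most \<open>1 / L\<close>.
\<close>

lemma not_null_density_return:
  assumes "\<not> null_density A"
  shows "\<exists>n\<ge>m. \<not> null_density {k \<in> A. k + n \<in> A}"
proof (rule ccontr)
  assume "\<not> ?thesis"
  then have null: "null_density {k \<in> A. k + n \<in> A}" if "n \<ge> m" for n
    using that by blast
  have "null_density A"
  proof (rule null_densityI)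
    fix e :: real assume "e > 0"
    \<comment> \<open>The successor makes the step positive even for \<open>m = 0\<close>, and its
      positive multiples are all at least \<open>m\<close>.\<close>
    define M where "M = Suc m"
    \<comment> \<open>One third of \<open>e\<close> each goes to \<open>1 / L\<close>, to the
      boundary term \<open>M / n\<close> and to the density of \<open>E\<close>.\<close>
    obtain L :: nat where L: "L > 3 / e" using reals_Archimedean2 by blast
    with \<open>e > 0\<close> have "L > 0"
      by (metis divide_pos_pos less_trans of_nat_0_less_iff zero_less_numeral)
    have L': "1 / real L < e / 3"
      using L \<open>e > 0\<close> \<open>L > 0\<close> by (simp add: field_simps)
    define E where "E = (\<Union>i\<in>{0<..<L}. {k \<in> A. k + M * i \<in> A})"
    have "null_density E"
      unfolding E_def
    proof (rule null_density_UN)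
      fix i assume "i \<in> {0<..<L}"
      then have "M * i \<ge> M * 1" by (intro mult_le_mono2) auto
      then show "null_density {k \<in> A. k + M * i \<in> A}"
        by (intro null) (simp add: M_def)
    qed simp
    have bound: "L * card ((A - E) \<inter> {1..n}) \<le> n + L * M" for n
      by (rule card_of_no_return) (auto simp: E_def M_def)
    have "(\<lambda>n. real M / real n) \<longlonglongrightarrow> 0"
      by (rule lim_const_over_n)
    then have "\<forall>\<^sub>F n in sequentially. real M / real n < e / 3"
      using \<open>e > 0\<close> by (intro order_tendstoD) auto
    moreover have "\<forall>\<^sub>F n in sequentially. real (card (E \<inter> {1..n})) / real n < e / 3"
      using \<open>null_density E\<close> \<open>e > 0\<close> by (intro null_densityD) auto
    ultimately show "\<forall>\<^sub>F n in sequentially. real (card (A \<inter> {1..n})) / real n < e"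
      using eventually_gt_at_top[of "0::nat"]
    proof eventually_elim
      case (elim n)
      have "card (A \<inter> {1..n}) \<le> card ((A - E) \<inter> {1..n} \<union> E \<inter> {1..n})"
        by (rule card_mono) auto
      also have "\<dots> \<le> card ((A - E) \<inter> {1..n}) + card (E \<inter> {1..n})"
        by (rule card_Un_le)
      finally have 1: "real (card (A \<inter> {1..n})) / real n
          \<le> (real (card ((A - E) \<inter> {1..n})) + real (card (E \<inter> {1..n}))) / real n"
        by (intro divide_right_mono) linarith+
      have "real L * real (card ((A - E) \<inter> {1..n})) \<le> real n + real L * real M"
        using bound[of n] by (metis of_nat_add of_nat_le_iff of_nat_mult)
      then have "real (card ((A - E) \<inter> {1..n})) / real n \<le> 1 / real L + real M / real n"
        using \<open>L > 0\<close> elim by (simp add: field_simps)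
      with 1 elim L' show ?case unfolding add_divide_distrib by linarith
    qed
  qed
  with assms show False by contradiction
qed

section \<open>Poisson stability from positive upper density\<close>

lemma funpow_mem:
  assumes "g ` K \<subseteq> K" "z \<in> K"
  shows "(g ^^ n) z \<in> K"
  using assms by (induction n) auto

lemma continuous_on_funpow:
  fixes g :: "'a::topological_space \<Rightarrow> 'a"
  assumes "continuous_on K g" "g ` K \<subseteq> K"
  shows "continuous_on K (g ^^ n)"
proof (induction n)
  case (Suc n)
  have "(g ^^ n) ` K \<subseteq> K" using funpow_mem[OF assms(2)] by blast
  then have "continuous_on K (g \<circ> (g ^^ n))"
    by (intro continuous_on_compose Suc continuous_on_subset[OF assms(1)])
  then show ?case by (simp add: o_def)
qed (simp add: id_def)

text \<open>Of finitely many pieces of \<open>C\<close> with diameter at most \<open>e\<close>, one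
  is visited on a set of times not of density zero. For a suitable return time \<open>n\<close> of
  that set, the points of the piece that \<open>g ^^ n\<close> maps back into it are still visited
  that often, and they move by at most \<open>e\<close>.\<close>

lemma density_recurrence_step:
  fixes K :: "'a::metric_space set"
  assumes g: "continuous_on K g" "g ` K \<subseteq> K"
    and C: "compact C" "C \<subseteq> K" "\<not> null_density {k. (g ^^ k) z \<in> C}" and "e > 0"
  shows "\<exists>C' n. compact C' \<and> C' \<subseteq> C \<and> \<not> null_density {k. (g ^^ k) z \<in> C'} \<and>
    n \<ge> m \<and> (\<forall>u\<in>C'. dist ((g ^^ n) u) u \<le> e)"
proof -
  obtain F where F: "finite F" "C \<subseteq> (\<Union>a\<in>F. ball a (e/2))"
    using C(1) \<open>e > 0\<close> unfolding compact_eq_totally_bounded by (meson half_gt_zero)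
  have "\<exists>a\<in>F. \<not> null_density {k. (g ^^ k) z \<in> C \<inter> cball a (e/2)}"
  proof (rule ccontr)
    assume "\<not> ?thesis"
    then have "null_density (\<Union>a\<in>F. {k. (g ^^ k) z \<in> C \<inter> cball a (e/2)})"
      using F(1) by (intro null_density_UN) auto
    moreover have "{k. (g ^^ k) z \<in> C} \<subseteq> (\<Union>a\<in>F. {k. (g ^^ k) z \<in> C \<inter> cball a (e/2)})"
      using F(2) by (auto simp: subset_iff) (meson less_imp_le)
    ultimately show False using C(3) null_density_subset by blast
  qed
  then obtain a where a: "\<not> null_density {k. (g ^^ k) z \<in> C \<inter> cball a (e/2)}" by blast
  define D where "D = C \<inter> cball a (e/2)"
  have D: "compact D" "D \<subseteq> K" "D \<subseteq> C"
    using C by (auto simp: D_def compact_Int_closed)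
  obtain n where n: "n \<ge> m"
    "\<not> null_density {k \<in> {k. (g ^^ k) z \<in> D}. k + n \<in> {k. (g ^^ k) z \<in> D}}"
    using not_null_density_return[OF a] unfolding D_def by blast
  \<comment> \<open>Visits to \<open>C'\<close> are exactly the times \<open>k\<close> for which
    both \<open>k\<close> and \<open>k + n\<close> are visits to \<open>D\<close>.\<close>
  define C' where "C' = D \<inter> (g ^^ n) -` D"
  have "continuous_on D (g ^^ n)"
    using continuous_on_funpow[OF g] D(2) continuous_on_subset by blast
  then have "closed C'"
    unfolding C'_def using D(1)
    by (intro continuous_closed_preimage compact_imp_closed)
  then have "compact C'"
    using D(1) unfolding C'_def by (metis compact_Int_closed inf.left_idem)
  moreover have "{k \<in> {k. (g ^^ k) z \<in> D}. k + n \<in> {k. (g ^^ k) z \<in> D}}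
      = {k. (g ^^ k) z \<in> C'}"
    by (auto simp: C'_def add.commute[of _ n] funpow_add)
  moreover have "dist u v \<le> e" if "u \<in> D" "v \<in> D" for u v
    using that dist_triangle_half_r[of a u e v] dist_triangle2[of u v a]
    by (auto simp: D_def dist_commute)
  ultimately show ?thesis
    using n D(3) by (intro exI[of _ C'] exI[of _ n]) (auto simp: C'_def)
qed

lemma poisson_stable_of_density:
  fixes K :: "'a::metric_space set"
  assumes g: "continuous_on K g" "g ` K \<subseteq> K"
    and C: "compact C" "C \<subseteq> K" "\<not> null_density {k. (g ^^ k) z \<in> C}"
  shows "\<exists>p\<in>C. poisson_stable K g p"
proof -
  define P where "P = (\<lambda>D. compact D \<and> D \<subseteq> C \<and> \<not> null_density {k. (g ^^ k) z \<in> D})"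
  \<comment> \<open>The same \<open>i\<close> bounds the return time from below and the displacement
    from above, so a common point of all the sets returns at arbitrarily late times.\<close>
  define R where "R = (\<lambda>(i::nat) D D'. D' \<subseteq> D \<and>
    (\<exists>n\<ge>i. \<forall>u\<in>D'. dist ((g ^^ n) u) u \<le> 1 / Suc i))"
  have "\<exists>S. \<forall>i. P (S i) \<and> R i (S i) (S (Suc i))"
  proof (rule dependent_nat_choice)
    show "\<exists>D. P D" using C by (auto simp: P_def)
  next
    fix D and i :: nat assume "P D"
    then have D: "compact D" "D \<subseteq> K" "D \<subseteq> C" "\<not> null_density {k. (g ^^ k) z \<in> D}"
      using C(2) by (auto simp: P_def)
    show "\<exists>D'. P D' \<and> R i D D'"
      using density_recurrence_step[OF g D(1,2,4), of "1 / Suc i" i] D(3)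
      unfolding P_def R_def by (force simp del: of_nat_Suc)
  qed
  then obtain S where P: "\<And>i. P (S i)" and R: "\<And>i. R i (S i) (S (Suc i))" by blast
  \<comment> \<open>The empty set is visited at no time, hence it fails \<open>P\<close>.\<close>
  have nonempty: "S i \<noteq> {}" for i
    using P[of i] null_density_empty unfolding P_def by auto
  have anti: "S j \<subseteq> S i" if "i \<le> j" for i j
    using that by (rule lift_Suc_antimono_le[rotated]) (use R in \<open>simp add: R_def\<close>)
  have "C \<inter> (\<Inter>i\<in>UNIV. S i) \<noteq> {}"
  proof (rule compact_imp_fip_image[OF C(1)])
    show "closed (S i)" for i using P[of i] by (simp add: P_def compact_imp_closed)
    fix I :: "nat set" assume "finite I"
    then obtain N where N: "\<And>i. i \<in> I \<Longrightarrow> i \<le> N" unfolding finite_nat_set_iff_bounded_le by blast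
    have "S N \<subseteq> C \<inter> (\<Inter>i\<in>I. S i)" using P[of N] anti N by (auto simp: P_def)
    then show "C \<inter> (\<Inter>i\<in>I. S i) \<noteq> {}" using nonempty[of N] by blast
  qed
  then obtain p where p: "p \<in> C" "\<And>i. p \<in> S i" by blast
  have "\<exists>n\<ge>i. dist ((g ^^ n) p) p \<le> 1 / Suc i" for i
    using R[of i] p(2)[of "Suc i"] unfolding R_def by blast
  then obtain n where n: "\<And>i. n i \<ge> i" "\<And>i. dist ((g ^^ n i) p) p \<le> 1 / Suc i" by metis
  have "filterlim n at_top sequentially"
    using n(1) by (intro filterlim_at_top_mono[OF filterlim_ident]) auto
  moreover have "(\<lambda>i. (g ^^ n i) p) \<longlonglongrightarrow> p"
    unfolding tendsto_dist_iff[of _ p]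
    by (rule tendsto_sandwich[OF _ _ tendsto_const LIMSEQ_Suc[OF lim_1_over_n]])
      (use n(2) in auto)
  ultimately show ?thesis
    using p(1) C(2) unfolding poisson_stable_def by blast
qed

section \<open>Visits of a minimal orbit\<close>

text \<open>By minimality and compactness every point of the orbit closure enters the ball at one of
  finitely many times. Hence finitely many shifts of the set of visits cover all times, and they
  cannot all be null.\<close>

lemma minimal_point_returns:
  fixes K :: "'a::metric_space set"
  assumes "compact K" and f: "continuous_on K f" "f ` K \<subseteq> K"
    and min: "minimal_point K f x" and "s > 0"
  shows "\<not> null_density {k. (f ^^ k) x \<in> ball x s}"
proof
  assume null: "null_density {k. (f ^^ k) x \<in> ball x s}"
  have "x \<in> K" using min by (simp add: minimal_point_def)
  define X where "X = closure (forward_orbit f x)"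
  have orbit: "(f ^^ k) x \<in> X" for k
    unfolding X_def forward_orbit_def by (intro subsetD[OF closure_subset]) auto
  have "X \<subseteq> K"
    unfolding X_def forward_orbit_def using assms(1) funpow_mem[OF f(2) \<open>x \<in> K\<close>]
    by (intro closure_minimal compact_imp_closed) auto
  moreover have "closed X" by (simp add: X_def)
  ultimately have "compact X"
    using assms(1) by (metis compact_Int_closed inf.absorb2)
  \<comment> \<open>The preimages of the ball are only relatively open in \<open>X\<close>; sets
    that are open in the ambient space replace them in the covering argument.\<close>
  have "\<exists>V. open V \<and> X \<inter> (f ^^ n) -` ball x s = X \<inter> V" for n
    using continuous_on_funpow[OF f, of n] \<open>X \<subseteq> K\<close>
      continuous_on_open_invariant[of X "f ^^ n"]
    by (metis continuous_on_subset inf_commute open_ball)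
  then obtain V where V: "\<And>n. open (V n)" "\<And>n. X \<inter> (f ^^ n) -` ball x s = X \<inter> V n" by metis
  have "X \<subseteq> (\<Union>n\<in>UNIV. V n)"
  proof
    fix y assume "y \<in> X"
    then have "closure (forward_orbit f y) = X"
      using min unfolding minimal_point_def X_def by blast
    then have "x \<in> closure (forward_orbit f y)" using orbit[of 0] by simp
    then obtain n where "(f ^^ n) y \<in> ball x s"
      using \<open>s > 0\<close> unfolding closure_approachable forward_orbit_def mem_ball dist_commute[of x]
      by blast
    then show "y \<in> (\<Union>n\<in>UNIV. V n)" using V(2)[of n] \<open>y \<in> X\<close> by blast
  qed
  then obtain N where N: "finite N" "X \<subseteq> (\<Union>n\<in>N. V n)"
    using compactE_image[OF \<open>compact X\<close>, of UNIV V] V(1) by auto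
  have "null_density (\<Union>n\<in>N. {k. k + n \<in> {k. (f ^^ k) x \<in> ball x s}})"
    using N(1) null by (intro null_density_UN null_density_shift)
  moreover have "(\<Union>n\<in>N. {k. k + n \<in> {k. (f ^^ k) x \<in> ball x s}}) = UNIV"
  proof -
    have "\<exists>n\<in>N. (f ^^ (k + n)) x \<in> ball x s" for k
    proof -
      obtain n where "n \<in> N" "(f ^^ k) x \<in> V n" using N(2) orbit[of k] by blast
      then have "(f ^^ n) ((f ^^ k) x) \<in> ball x s" using V(2)[of n] orbit[of k] by blast
      then show ?thesis using \<open>n \<in> N\<close> by (auto simp: add.commute[of k] funpow_add)
    qed
    then show ?thesis by blast
  qed
  ultimately show False using not_null_density_UNIV by simp
qed

section \<open>Transfer of visits by EIS\<close>

text \<open>This is the test function for \<open>EIS\<close>: for \<open>r > 0\<close>, a bump of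
  height \<open>r\<close> at \<open>x\<close> that vanishes outside \<open>ball x r\<close>.\<close>

lemma bump_Lip1: "(\<lambda>z. max 0 (r - dist x z)) \<in> Lip1 K"
  unfolding Lip1_def
proof (clarsimp, rule lipschitz_onI)
  fix y z
  have "\<bar>dist x y - dist x z\<bar> \<le> dist y z"
    using abs_dist_diff_le[of y x z] by (simp add: dist_commute[of y x])
  then show "dist (max 0 (r - dist x y)) (max 0 (r - dist x z)) \<le> 1 * dist y z"
    unfolding dist_real_def by linarith
qed simp

text \<open>The bump of radius \<open>2 * s\<close> is at least \<open>s\<close> on
  \<open>ball x s\<close> and at most \<open>2 * s\<close> times the indicator of
  \<open>cball x (2 * s)\<close>. If the visits of the \<open>g\<close>-orbit had density zero,
  \<open>EIS\<close> would push the visit frequency of the \<open>f\<close>-orbit below a level that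
  it reaches infinitely often.\<close>

lemma EIS_density_transfer:
  fixes K :: "'a::metric_space set"
  assumes "EIS K f" "x \<in> K" "s > 0" and visits: "\<not> null_density {k. (f ^^ k) x \<in> ball x s}"
  shows "\<exists>d>0. \<forall>g \<in> cont_self_maps K. dist_C0 K g f \<le> d \<longrightarrow>
    (\<exists>z\<in>K. \<not> null_density {k. (g ^^ k) z \<in> cball x (2 * s)})"
proof -
  let ?A = "{k. (f ^^ k) x \<in> ball x s}"
  obtain c where c: "c > 0"
    "\<not> (\<forall>\<^sub>F n in sequentially. real (card (?A \<inter> {1..n})) / real n < c)"
    using visits null_densityI by blast
  \<comment> \<open>Below, \<open>2 * \<epsilon>\<close> comes from the upper limit and
    \<open>\<epsilon>\<close> from the visits in \<open>?B\<close>; together they make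
    \<open>s * c\<close>.\<close>
  define \<epsilon> where "\<epsilon> = s * c / 3"
  have "\<epsilon> > 0" using \<open>s > 0\<close> c by (simp add: \<epsilon>_def)
  with assms(1,2) obtain d where d: "d > 0"
    "\<And>g. d_method K d f g \<Longrightarrow> \<exists>y. method_trajectory K g y \<and> (\<forall>\<phi>\<in>Lip1 K.
      limsup (\<lambda>n. ereal (1 / real n * (\<Sum>k=1..n. (\<phi> ((f ^^ k) x) - \<phi> (y k))))) \<le> ereal \<epsilon>)"
    unfolding EIS_def by blast
  define \<phi> where "\<phi> = (\<lambda>z. max 0 (2 * s - dist x z))"
  have "\<phi> \<in> Lip1 K" unfolding \<phi>_def by (rule bump_Lip1)
  have "\<exists>z\<in>K. \<not> null_density {k. (g ^^ k) z \<in> cball x (2 * s)}"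
    if g: "g \<in> cont_self_maps K" "dist_C0 K g f \<le> d" for g
  proof -
    \<comment> \<open>The trajectories of the constant method are the orbits of
      \<open>g\<close>.\<close>
    have "d_method K d f (\<lambda>_. g)"
      using g by (simp add: d_method_def is_method_def)
    from d(2)[OF this] obtain y where y: "method_trajectory K (\<lambda>_. g) y"
      and "limsup (\<lambda>n. ereal (1 / real n * (\<Sum>k=1..n. (\<phi> ((f ^^ k) x) - \<phi> (y k))))) \<le> ereal \<epsilon>"
      using \<open>\<phi> \<in> Lip1 K\<close> by blast
    note this(2)
    also have "ereal \<epsilon> < ereal (2 * \<epsilon>)" using \<open>\<epsilon> > 0\<close> by simp
    finally have "limsup (\<lambda>n. ereal (1 / real n * (\<Sum>k=1..n. (\<phi> ((f ^^ k) x) - \<phi> (y k)))))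
        < ereal (2 * \<epsilon>)" .
    from Limsup_lessD[OF this] have less:
      "\<forall>\<^sub>F n in sequentially. 1 / real n * (\<Sum>k=1..n. (\<phi> ((f ^^ k) x) - \<phi> (y k))) < 2 * \<epsilon>"
      by simp
    have y_eq: "(g ^^ k) (y 0) = y k" for k
      using y unfolding method_trajectory_def by (induction k) auto
    let ?B = "{k. y k \<in> cball x (2 * s)}"
    have "\<not> null_density ?B"
    proof
      assume "null_density ?B"
      then have "\<forall>\<^sub>F n in sequentially. real (card (?B \<inter> {1..n})) / real n < \<epsilon> / (2 * s)"
        using \<open>\<epsilon> > 0\<close> \<open>s > 0\<close> by (intro null_densityD) auto
      with less have "\<forall>\<^sub>F n in sequentially. real (card (?A \<inter> {1..n})) / real n < c"
      proof eventually_elim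
        case (elim n)
        have "s * indicator ?A k - 2 * s * indicator ?B k \<le> \<phi> ((f ^^ k) x) - \<phi> (y k)" for k
        proof -
          have "s * indicator ?A k \<le> \<phi> ((f ^^ k) x)"
            using \<open>s > 0\<close> by (auto simp: \<phi>_def indicator_def)
          moreover have "\<phi> (y k) \<le> 2 * s * indicator ?B k"
            using \<open>s > 0\<close> by (auto simp: \<phi>_def indicator_def)
          ultimately show ?thesis by linarith
        qed
        then have "(\<Sum>k=1..n. s * indicator ?A k - 2 * s * indicator ?B k)
            \<le> (\<Sum>k=1..n. \<phi> ((f ^^ k) x) - \<phi> (y k))"
          by (rule sum_mono)
        also have "(\<Sum>k=1..n. s * indicator ?A k - 2 * s * indicator ?B k)
            = s * real (card (?A \<inter> {1..n})) - 2 * s * real (card (?B \<inter> {1..n}))"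
          by (simp add: sum_subtractf indicator_def sum_of_bool_eq Int_commute
              flip: sum_distrib_left)
        finally have "(s * real (card (?A \<inter> {1..n})) - 2 * s * real (card (?B \<inter> {1..n}))) / real n
            \<le> (\<Sum>k=1..n. \<phi> ((f ^^ k) x) - \<phi> (y k)) / real n"
          by (rule divide_right_mono) simp
        with elim(1) have "s * (real (card (?A \<inter> {1..n})) / real n)
            - 2 * s * (real (card (?B \<inter> {1..n})) / real n) < 2 * \<epsilon>"
          by (simp add: diff_divide_distrib)
        moreover have "2 * s * (real (card (?B \<inter> {1..n})) / real n) < \<epsilon>"
          using elim(2) \<open>s > 0\<close> by (simp add: pos_less_divide_eq mult.commute)
        ultimately have "s * (real (card (?A \<inter> {1..n})) / real n) < s * c"
          unfolding \<epsilon>_def by linarith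
        then show ?case using \<open>s > 0\<close> by (simp only: mult_less_cancel_left_pos)
      qed
      with c(2) show False by contradiction
    qed
    moreover have "y 0 \<in> K" using y by (simp add: method_trajectory_def)
    ultimately show ?thesis by (intro bexI[of _ "y 0"]) (simp_all add: y_eq)
  qed
  with d(1) show ?thesis by blast
qed

section \<open>From one minimal point to all of them\<close>

text \<open>Here \<open>d\<close> may depend on \<open>x\<close>, since the frequency of returns
  does.\<close>

lemma poisson_stable_near_minimal_point:
  fixes K :: "'a::metric_space set"
  assumes "compact K" "continuous_on K f" "f ` K \<subseteq> K" "EIS K f"
    and min: "minimal_point K f x" and "r > 0"
  shows "\<exists>d>0. \<forall>g \<in> cont_self_maps K. dist_C0 K f g \<le> d \<longrightarrow>
    (\<exists>p \<in> cball x r. poisson_stable K g p)"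
proof -
  have "x \<in> K" using min by (simp add: minimal_point_def)
  have "r / 2 > 0" using \<open>r > 0\<close> by simp
  from EIS_density_transfer[OF assms(4) \<open>x \<in> K\<close> this
      minimal_point_returns[OF assms(1-3) min this]]
  obtain d where d: "d > 0" "\<And>g. g \<in> cont_self_maps K \<Longrightarrow> dist_C0 K g f \<le> d \<Longrightarrow>
      \<exists>z\<in>K. \<not> null_density {k. (g ^^ k) z \<in> cball x r}"
    by auto
  have "\<exists>p \<in> cball x r. poisson_stable K g p"
    if g: "g \<in> cont_self_maps K" "dist_C0 K f g \<le> d" for g
  proof -
    have g': "continuous_on K g" "g ` K \<subseteq> K"
      using g(1) by (auto simp: cont_self_maps_def)
    have "dist_C0 K g f \<le> d"
      using g(2) by (simp add: dist_C0_def dist_commute)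
    then obtain z where z: "z \<in> K" "\<not> null_density {k. (g ^^ k) z \<in> cball x r}"
      using d(2) g(1) by blast
    \<comment> \<open>Closed balls of the ambient space need not be compact, but their intersections
      with \<open>K\<close> are.\<close>
    have "\<not> null_density {k. (g ^^ k) z \<in> K \<inter> cball x r}"
      using z funpow_mem[OF g'(2) z(1)] by simp
    from poisson_stable_of_density[OF g' _ _ this] show ?thesis
      using assms(1) by (auto simp: compact_Int_closed)
  qed
  with d(1) show ?thesis by blast
qed

theorem proposition3p4:
  fixes K :: "'a::metric_space set" and f :: "'a \<Rightarrow> 'a"
  assumes "compact K"
    and "continuous_on K f"
    and "f ` K = K"
    and "EIS K f"
  shows "\<forall>\<epsilon>>0. \<exists>d>0. \<forall>g \<in> cont_self_maps K. dist_C0 K f g < d \<longrightarrow>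
           (\<forall>x. minimal_point K f x \<longrightarrow> (\<exists>p \<in> ball x \<epsilon>. poisson_stable K g p))"
proof (intro allI impI)
  fix \<epsilon> :: real assume "\<epsilon> > 0"
  \<comment> \<open>The distances from \<open>x\<close> to \<open>a\<close>, from \<open>a\<close>
    to \<open>c a\<close> and from \<open>c a\<close> to \<open>p\<close> are each at most
    \<open>\<epsilon> / 4\<close>, which leaves room to spare.\<close>
  then have "\<epsilon> / 4 > 0" by simp
  then obtain F where F: "finite F" "K \<subseteq> (\<Union>a\<in>F. ball a (\<epsilon> / 4))"
    using assms(1) unfolding compact_eq_totally_bounded by blast
  \<comment> \<open>One minimal point \<open>c a\<close> is picked for each centre that has one
    nearby; a minimum over the finite set \<open>G\<close> is then uniform in
    \<open>x\<close>.\<close>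
  define G where "G = {a\<in>F. \<exists>x\<in>ball a (\<epsilon> / 4). minimal_point K f x}"
  have "\<forall>a\<in>G. \<exists>x. x \<in> ball a (\<epsilon> / 4) \<and> minimal_point K f x"
    by (auto simp: G_def)
  then obtain c where c: "\<And>a. a \<in> G \<Longrightarrow> c a \<in> ball a (\<epsilon> / 4) \<and> minimal_point K f (c a)"
    by metis
  have "\<forall>a\<in>G. \<exists>d>0. \<forall>g \<in> cont_self_maps K. dist_C0 K f g \<le> d \<longrightarrow>
      (\<exists>p \<in> cball (c a) (\<epsilon> / 4). poisson_stable K g p)"
    using poisson_stable_near_minimal_point[OF assms(1,2) _ assms(4) _ \<open>\<epsilon> / 4 > 0\<close>] assms(3) c
    by blast
  then obtain d where d: "\<And>a. a \<in> G \<Longrightarrow> d a > 0"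
    "\<And>a g. a \<in> G \<Longrightarrow> g \<in> cont_self_maps K \<Longrightarrow> dist_C0 K f g \<le> d a \<Longrightarrow>
      \<exists>p \<in> cball (c a) (\<epsilon> / 4). poisson_stable K g p"
    by metis
  \<comment> \<open>The 1 covers the case of empty \<open>G\<close>, in which there is no minimal
    point.\<close>
  define d0 where "d0 = Min (insert 1 (d ` G))"
  have "finite G" using F(1) by (simp add: G_def)
  then have d0: "d0 > 0" "\<And>a. a \<in> G \<Longrightarrow> d0 \<le> d a"
    using d(1) by (auto simp: d0_def)
  have "\<exists>p \<in> ball x \<epsilon>. poisson_stable K g p"
    if g: "g \<in> cont_self_maps K" "dist_C0 K f g < d0" and x: "minimal_point K f x" for g x
  proof -
    have "x \<in> K" using x by (simp add: minimal_point_def)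
    then obtain a where a: "a \<in> F" "x \<in> ball a (\<epsilon> / 4)" using F(2) by blast
    with x have "a \<in> G" by (auto simp: G_def)
    then obtain p where p: "p \<in> cball (c a) (\<epsilon> / 4)" "poisson_stable K g p"
      using d(2)[of a g] d0(2)[of a] g by force
    have "dist x p < \<epsilon>"
      using a(2) c[OF \<open>a \<in> G\<close>] p(1) dist_triangle[of x p a] dist_triangle[of a p "c a"] \<open>\<epsilon> > 0\<close>
      by (simp add: dist_commute)
    with p(2) show ?thesis by auto
  qed
  with d0(1) show "\<exists>d>0. \<forall>g \<in> cont_self_maps K. dist_C0 K f g < d \<longrightarrow>
      (\<forall>x. minimal_point K f x \<longrightarrow> (\<exists>p \<in> ball x \<epsilon>. poisson_stable K g p))"
    by blast
qed

end
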